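(* Let $s\in(0,1)$ and $c=1-2^{s-1}$. For any $X\in2^\omega$ with $\dim(X)=s$ and any $t\in(1-H(c),s)$, there is a sequence $Z$ with $\dim(Z)\le t$ and $$d(X,Z)\le\frac{c}{s-1+H(c)}(s-t).$$
   Context: $K$ is prefix-free Kolmogorov complexity; $\dim(X)=\liminf_nK(X\restriction n)/n$. $d(X,Z)=\limsup_n|\{m<n:X(m)\ne Z(m)\}|/n$. $H$ is binary entropy. *)

theory Defs
  imports Complex_Main "HOL-Library.Sublist" "HOL-Library.Extended_Real" "HOL-Library.Liminf_Limsup"
begin

datatype recf = Zero | Succ | Proj nat | Comp recf "recf list" | Prec recf recf | Mn recf

inductive eval :: "recf \<Rightarrow> nat list \<Rightarrow> nat \<Rightarrow> bool" where
  eval_Zero: "eval Zero xs 0"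
| eval_Succ: "eval Succ (x # xs) (Suc x)"
| eval_Proj: "i < length xs \<Longrightarrow> eval (Proj i) xs (xs ! i)"
| eval_Comp: "length ys = length gs \<Longrightarrow> (\<forall>i < length gs. eval (gs ! i) xs (ys ! i))
      \<Longrightarrow> eval f ys z \<Longrightarrow> eval (Comp f gs) xs z"
| eval_Prec0: "eval f xs z \<Longrightarrow> eval (Prec f g) (0 # xs) z"
| eval_PrecS: "eval (Prec f g) (n # xs) y \<Longrightarrow> eval g (y # n # xs) z
      \<Longrightarrow> eval (Prec f g) (Suc n # xs) z"
| eval_Mn: "eval f (n # xs) 0 \<Longrightarrow> (\<forall>m < n. \<exists>k. 0 < k \<and> eval f (m # xs) k)
      \<Longrightarrow> eval (Mn f) xs n"

section \<open>Binary strings coded as natural numbers (bijection)\<close>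

fun bl_code :: "bool list \<Rightarrow> nat" where
  "bl_code [] = 0"
| "bl_code (b # bs) = 2 * bl_code bs + (if b then 2 else 1)"

definition partial_computable :: "(bool list \<Rightarrow> bool list option) \<Rightarrow> bool" where
  "partial_computable M \<longleftrightarrow>
     (\<exists>f. \<forall>p y. M p = Some y \<longleftrightarrow> eval f [bl_code p] (bl_code y))"

definition prefix_free_machine :: "(bool list \<Rightarrow> bool list option) \<Rightarrow> bool" where
  "prefix_free_machine M \<longleftrightarrow> partial_computable M \<and>
     (\<forall>p q. M p \<noteq> None \<longrightarrow> M q \<noteq> None \<longrightarrow> prefix p q \<longrightarrow> p = q)"

definition universal_pf :: "(bool list \<Rightarrow> bool list option) \<Rightarrow> bool" where
  "universal_pf U \<longleftrightarrow> prefix_free_machine U \<and>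
     (\<forall>M. prefix_free_machine M \<longrightarrow>
        (\<exists>c::nat. \<forall>p x. M p = Some x \<longrightarrow> (\<exists>q. U q = Some x \<and> length q \<le> length p + c)))"

definition KC :: "(bool list \<Rightarrow> bool list option) \<Rightarrow> bool list \<Rightarrow> nat" where
  "KC U x = (LEAST n. \<exists>p. U p = Some x \<and> length p = n)"

definition prefix_of :: "(nat \<Rightarrow> bool) \<Rightarrow> nat \<Rightarrow> bool list" where
  "prefix_of X n = map X [0..<n]"

definition eff_dim :: "(bool list \<Rightarrow> bool list option) \<Rightarrow> (nat \<Rightarrow> bool) \<Rightarrow> ereal" where
  "eff_dim U X = liminf (\<lambda>n. ereal (real (KC U (prefix_of X n)) / real n))"

definition seq_dist :: "(nat \<Rightarrow> bool) \<Rightarrow> (nat \<Rightarrow> bool) \<Rightarrow> ereal" where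
  "seq_dist X Z = limsup (\<lambda>n. ereal (real (card {m. m < n \<and> X m \<noteq> Z m}) / real n))"

definition bin_entropy :: "real \<Rightarrow> real" where
  "bin_entropy x = - x * log 2 x - (1 - x) * log 2 (1 - x)"

end

(*
  Leave X unchanged except on sparse segments [n, m) with K(X|n) <= (s + eps) n and
  (m - n)/m close to lambda = (s - t)/(s - 1 + H(c)). Such a segment is cut into blocks of a constant
  length L, and each block is replaced by the nearest word of a covering code of radius cL and rate
  1 - H(c) + eps. Then K(Z|m)/m <= (1 - lambda) s + lambda (1 - H(c)) + o(1) = t + o(1), while the
  fraction of changed bits in a prefix rises from nearly 0 to at most c lambda and then decays.
  As L is fixed along a segment, the code is a finite table built into a prefix-free machine whose
  additive constant is absorbed by choosing n large.
*)

theory Submission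
  imports Defs "HOL-Real_Asymp.Real_Asymp"
begin

section \<open>Total recursive functions\<close>

text \<open>An unchanged prefix costs about s per bit and a coded segment about 1 - H(c) per bit;
  the average is t exactly when the segment takes the fraction lambda. Every c in (0,1) with 1 -
  H(c) < t < s yields a bound with slope c / (s - 1 + H(c)). The given c makes this slope least: its
  derivative has the sign of s - 1 - log2(1 - c), which vanishes at 1 - c = 2^(s-1).

  At a later segment the prefix to be described is no longer X|n, because earlier segments have been
  altered. The finite string built so far is therefore wired into the machine too, and overwrites
  the beginning of the output of a program for X|n. The additive constant depends on this string and
  on the code, so n is chosen only after both are fixed.

  The covering code comes from a counting argument that yields no algorithm. This is harmless: an
  arbitrary function of boundedly many bits is computed by a finite case distinction.\<close>

definition computable :: "nat \<Rightarrow> (nat list \<Rightarrow> nat) \<Rightarrow> bool" where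
  "computable n F \<longleftrightarrow> (\<exists>r. \<forall>xs. length xs = n \<longrightarrow> (\<forall>y. eval r xs y \<longleftrightarrow> y = F xs))"

text \<open>\<open>eval\<close> is only a relation. Single-valuedness is part of the equivalence in
  \<open>computable\<close> and is obtained function by function from inversion equations such as
  this one.\<close>

lemma eval_Zero_iff: "eval Zero xs y \<longleftrightarrow> y = 0"
  by (subst eval.simps) auto

lemma eval_Succ_iff: "eval Succ xs y \<longleftrightarrow> xs \<noteq> [] \<and> y = Suc (hd xs)"
  by (subst eval.simps) (auto simp: neq_Nil_conv)

lemma eval_Proj_iff: "eval (Proj i) xs y \<longleftrightarrow> i < length xs \<and> y = xs ! i"
  by (subst eval.simps) auto

lemma eval_Comp_iff:
  "eval (Comp f gs) xs z \<longleftrightarrow>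
     (\<exists>ys. length ys = length gs \<and> (\<forall>i < length gs. eval (gs ! i) xs (ys ! i)) \<and> eval f ys z)"
  by (subst eval.simps) auto

lemma eval_Prec_0_iff: "eval (Prec f g) (0 # xs) z \<longleftrightarrow> eval f xs z"
  by (subst eval.simps) auto

lemma eval_Prec_Suc_iff:
  "eval (Prec f g) (Suc n # xs) z \<longleftrightarrow> (\<exists>y. eval (Prec f g) (n # xs) y \<and> eval g (y # n # xs) z)"
  by (subst eval.simps) auto

lemma computable_proj: "i < n \<Longrightarrow> computable n (\<lambda>xs. xs ! i)"
  unfolding computable_def by (rule exI[of _ "Proj i"]) (simp add: eval_Proj_iff)

lemma computable_comp:
  assumes F: "computable (length Gs) F" and G: "\<forall>G\<in>set Gs. computable n G"
  shows "computable n (\<lambda>xs. F (map (\<lambda>G. G xs) Gs))"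
proof -
  obtain r where r: "\<And>xs y. length xs = length Gs \<Longrightarrow> eval r xs y \<longleftrightarrow> y = F xs"
    using F unfolding computable_def by blast
  obtain g where g: "\<And>G xs y. G \<in> set Gs \<Longrightarrow> length xs = n \<Longrightarrow> eval (g G) xs y \<longleftrightarrow> y = G xs"
    using G unfolding computable_def by metis
  have "eval (Comp r (map g Gs)) xs y \<longleftrightarrow> y = F (map (\<lambda>G. G xs) Gs)" if "length xs = n" for xs y
  proof -
    have "length ys = length Gs \<and> (\<forall>i<length Gs. ys ! i = (Gs ! i) xs)
        \<longleftrightarrow> ys = map (\<lambda>G. G xs) Gs" for ys
      by (auto simp: list_eq_iff_nth_eq)
    then have "eval (Comp r (map g Gs)) xs y \<longleftrightarrow>
        (\<exists>ys. ys = map (\<lambda>G. G xs) Gs \<and> eval r ys y)"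
      unfolding eval_Comp_iff using g[OF nth_mem that]
      by (smt (verit) length_map nth_map)
    then show ?thesis
      using r by simp
  qed
  then show ?thesis
    unfolding computable_def by blast
qed

lemma computable_comp1:
  assumes "computable 1 (\<lambda>xs. f (xs ! 0))" "computable n G"
  shows "computable n (\<lambda>xs. f (G xs))"
  using computable_comp[of "[G]" "\<lambda>xs. f (xs ! 0)" n] assms by simp

lemma computable_comp2:
  assumes "computable 2 (\<lambda>xs. f (xs ! 0) (xs ! 1))" "computable n G" "computable n H"
  shows "computable n (\<lambda>xs. f (G xs) (H xs))"
  using computable_comp[of "[G, H]" "\<lambda>xs. f (xs ! 0) (xs ! 1)" n] assms
  by (simp add: numeral_2_eq_2)

lemma computable_comp3:
  assumes "computable 3 (\<lambda>xs. f (xs ! 0) (xs ! 1) (xs ! 2))"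
    "computable n G" "computable n H" "computable n I"
  shows "computable n (\<lambda>xs. f (G xs) (H xs) (I xs))"
  using computable_comp[of "[G, H, I]" "\<lambda>xs. f (xs ! 0) (xs ! 1) (xs ! 2)" n] assms
  by (simp add: numeral_3_eq_3 numeral_2_eq_2)

lemma computable_Suc: "computable n F \<Longrightarrow> computable n (\<lambda>xs. Suc (F xs))"
proof (rule computable_comp1[of Suc])
  show "computable 1 (\<lambda>xs. Suc (xs ! 0))"
    unfolding computable_def
    by (rule exI[of _ Succ]) (auto simp: eval_Succ_iff length_Suc_conv)
qed

lemma computable_const: "computable n (\<lambda>xs. k)"
proof (induction k)
  case 0
  then show ?case
    unfolding computable_def by (rule exI[of _ Zero]) (simp add: eval_Zero_iff)
qed (rule computable_Suc)

lemma computable_prec: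
  assumes F: "computable n F" and G: "computable (Suc (Suc n)) G"
    and f0: "\<And>xs. length xs = n \<Longrightarrow> f (0 # xs) = F xs"
    and fS: "\<And>xs i. length xs = n \<Longrightarrow> f (Suc i # xs) = G (f (i # xs) # i # xs)"
  shows "computable (Suc n) f"
proof -
  obtain r where r: "\<And>xs y. length xs = n \<Longrightarrow> eval r xs y \<longleftrightarrow> y = F xs"
    using F unfolding computable_def by blast
  obtain g where g: "\<And>xs y. length xs = Suc (Suc n) \<Longrightarrow> eval g xs y \<longleftrightarrow> y = G xs"
    using G unfolding computable_def by blast
  have *: "eval (Prec r g) (i # xs) y \<longleftrightarrow> y = f (i # xs)" if "length xs = n" for i xs y
    using that by (induction i arbitrary: y) (auto simp: eval_Prec_0_iff eval_Prec_Suc_iff r g f0 fS)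
  then show ?thesis
    unfolding computable_def
    by (intro exI[of _ "Prec r g"]) (auto simp: length_Suc_conv)
qed

lemma computable_rec1:
  assumes "computable 2 (\<lambda>xs. g (xs ! 0) (xs ! 1))" "\<And>i. f (Suc i) = g (f i) i" "computable n N"
  shows "computable n (\<lambda>xs. f (N xs))"
  by (rule computable_comp1[OF computable_prec[of 0 "\<lambda>xs. f 0" "\<lambda>xs. g (xs ! 0) (xs ! 1)", folded One_nat_def]])
    (use assms in \<open>simp_all add: computable_const numeral_2_eq_2\<close>)

lemma computable_rec2:
  assumes "computable 1 (\<lambda>xs. f 0 (xs ! 0))" "computable 3 (\<lambda>xs. g (xs ! 0) (xs ! 1) (xs ! 2))"
    "\<And>i x. f (Suc i) x = g (f i x) i x" "computable n N" "computable n A"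
  shows "computable n (\<lambda>xs. f (N xs) (A xs))"
  by (rule computable_comp2[OF computable_prec[of 1 "\<lambda>xs. f 0 (xs ! 0)"
        "\<lambda>xs. g (xs ! 0) (xs ! 1) (xs ! 2)", unfolded Suc_1]])
    (use assms in \<open>simp_all add: numeral_3_eq_3 numeral_2_eq_2\<close>)

section \<open>Elementary arithmetic by primitive recursion\<close>

lemma computable_add:
  assumes "computable n F" "computable n G"
  shows "computable n (\<lambda>xs. F xs + G xs)"
  by (rule computable_rec2[where g = "\<lambda>y i x. Suc y"])
    (use assms in \<open>auto intro!: computable_proj computable_Suc\<close>)

lemma computable_mult:
  assumes "computable n F" "computable n G"
  shows "computable n (\<lambda>xs. F xs * G xs)"
  by (rule computable_rec2[where g = "\<lambda>y i x. y + x"])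
    (use assms in \<open>auto intro!: computable_proj computable_add computable_const\<close>)

lemma computable_pred:
  assumes "computable n F"
  shows "computable n (\<lambda>xs. F xs - 1)"
  by (rule computable_rec1[where g = "\<lambda>y i. i" and f = "\<lambda>n. n - 1"])
    (use assms in \<open>auto intro!: computable_proj\<close>)

lemma computable_diff:
  assumes "computable n F" "computable n G"
  shows "computable n (\<lambda>xs. F xs - G xs)"
  by (rule computable_rec2[where g = "\<lambda>y i x. y - 1" and f = "\<lambda>i x. x - i"])
    (use assms in \<open>auto intro!: computable_proj computable_pred simp del: One_nat_def\<close>)

lemma computable_if_zero:
  assumes "computable n F" "computable n A" "computable n B"
  shows "computable n (\<lambda>xs. if F xs = 0 then A xs else B xs)"
proof (rule computable_comp3[where f = "\<lambda>x a b. if x = 0 then a else b", OF _ assms])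
  show "computable 3 (\<lambda>xs. if xs ! 0 = 0 then xs ! 1 else xs ! 2)"
    \<comment> \<open>A case distinction is a recursion whose step ignores the previous value. The
      step sees the list of previous value, index, a, b, hence position 3.\<close>
    unfolding numeral_3_eq_3
    by (rule computable_prec[of _ "\<lambda>xs. xs ! 0" "\<lambda>xs. xs ! 3"])
      (auto intro!: computable_proj simp: numeral_eq_Suc)
qed

lemma computable_mod2:
  assumes "computable n F"
  shows "computable n (\<lambda>xs. F xs mod 2)"
  by (rule computable_rec1[where g = "\<lambda>y i. 1 - y" and f = "\<lambda>n. n mod 2"])
    (use assms in \<open>auto intro!: computable_proj computable_diff computable_const
        simp: mod_Suc\<close>)

lemma computable_div2:
  assumes "computable n F"
  shows "computable n (\<lambda>xs. F xs div 2)"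
  by (rule computable_rec1[where g = "\<lambda>y i. y + i mod 2" and f = "\<lambda>n. n div 2"])
    (use assms in \<open>auto intro!: computable_proj computable_add computable_mod2,
      presburger\<close>)

section \<open>Strings as numbers, and string functions computed on codes\<close>

lemma inj_bl_code: "inj bl_code"
proof (rule injI)
  fix x y show "bl_code x = bl_code y \<Longrightarrow> x = y"
  proof (induction x arbitrary: y)
    case Nil
    then show ?case by (cases y) (auto split: if_splits)
  next
    case (Cons a x)
    then show ?case
      by (cases y; cases a; cases "hd y") (auto, presburger+)
  qed
qed

lemma bl_code_eq_iff [simp]: "bl_code p = bl_code q \<longleftrightarrow> p = q"
  using inj_bl_code by (auto dest: injD)

text \<open>\<open>bl_code\<close> is bijective binary notation with the digits 1 and 2, least
  significant digit first, so every number has an expansion.\<close>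

lemma bl_code_surj: "\<exists>p. bl_code p = n"
proof (induction n rule: less_induct)
  case (less n)
  show ?case
  proof (cases n)
    case 0
    then show ?thesis by (auto intro: exI[of _ "[]"])
  next
    case (Suc m)
    then obtain p where p: "bl_code p = m div 2"
      using less[of "m div 2"] by (auto simp: le_imp_less_Suc)
    show ?thesis
      by (rule exI[of _ "odd m # p"]) (auto simp: p Suc)
  qed
qed

definition bl_dec :: "nat \<Rightarrow> bool list" where "bl_dec = inv bl_code"

lemma bl_dec_code [simp]: "bl_dec (bl_code p) = p"
  by (simp add: bl_dec_def inv_f_f[OF inj_bl_code])

lemma bl_code_dec [simp]: "bl_code (bl_dec n) = n"
  using bl_code_surj[of n] by (auto simp: bl_dec_def inv_f_f[OF inj_bl_code])

lemma length_le_bl_code: "length p \<le> bl_code p"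
  by (induction p) auto

lemma bl_code_append: "bl_code (p @ q) = bl_code p + 2 ^ length p * bl_code q"
  by (induction p) (auto simp: algebra_simps)

lemma bl_code_bounds: "2 ^ length p \<le> Suc (bl_code p)" "Suc (bl_code p) < 2 ^ Suc (length p)"
  by (induction p) auto

definition lcomputable :: "nat \<Rightarrow> (nat list \<Rightarrow> bool list) \<Rightarrow> bool" where
  "lcomputable n F \<longleftrightarrow> computable n (\<lambda>xs. bl_code (F xs))"

lemma lcomputable_proj: "i < n \<Longrightarrow> lcomputable n (\<lambda>xs. bl_dec (xs ! i))"
  by (simp add: lcomputable_def computable_proj)

lemma lcomputable_const: "lcomputable n (\<lambda>xs. p)"
  by (simp add: lcomputable_def computable_const)

lemma lcomputable_comp1:
  assumes "lcomputable 1 (\<lambda>xs. f (bl_dec (xs ! 0)))" "lcomputable n G"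
  shows "lcomputable n (\<lambda>xs. f (G xs))"
  using computable_comp1[of "\<lambda>x. bl_code (f (bl_dec x))" n "\<lambda>xs. bl_code (G xs)"] assms
  by (simp add: lcomputable_def)

lemma bl_code_tl: "bl_code (tl p) = (bl_code p - 1) div 2"
  by (cases p) auto

lemma lcomputable_tl: "lcomputable n F \<Longrightarrow> lcomputable n (\<lambda>xs. tl (F xs))"
  unfolding lcomputable_def bl_code_tl by (intro computable_div2 computable_pred)

lemma lcomputable_drop: "lcomputable n F \<Longrightarrow> lcomputable n (\<lambda>xs. drop k (F xs))"
  by (induction k) (simp_all add: drop_Suc lcomputable_tl flip: tl_drop)

text \<open>The three cases can be read off the code: 0 for the empty string, positive and even for
  head \<open>True\<close>, odd for head \<open>False\<close>.\<close>

lemma lcomputable_case: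
  assumes "lcomputable n F" "lcomputable n A" "lcomputable n B" "lcomputable n C"
  shows "lcomputable n (\<lambda>xs. case F xs of [] \<Rightarrow> A xs | b # _ \<Rightarrow> if b then B xs else C xs)"
proof -
  have *: "bl_code (case p of [] \<Rightarrow> a | b # _ \<Rightarrow> if b then a' else a'') =
     (if bl_code p = 0 then bl_code a else if bl_code p mod 2 = 0 then bl_code a' else bl_code a'')"
    for p a a' a''
    by (cases p) auto
  show ?thesis
    using assms unfolding lcomputable_def *
    by (intro computable_if_zero computable_mod2)
qed

text \<open>Here \<open>C\<close> is arbitrary. Only finitely many strings of length at most k
  exist, and the induction unfolds \<open>C\<close> into a decision tree on the first k bits. This
  is what admits a covering code obtained by pure existence.\<close>

lemma lcomputable_take:
  assumes "lcomputable n F"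
  shows "lcomputable n (\<lambda>xs. C (take k (F xs)))"
proof (rule lcomputable_comp1[OF _ assms])
  show "lcomputable 1 (\<lambda>xs. C (take k (bl_dec (xs ! 0))))"
  proof (induction k arbitrary: C)
    case 0
    then show ?case by (simp add: lcomputable_const)
  next
    case (Suc k)
    have *: "C (take (Suc k) p) = (case p of [] \<Rightarrow> C [] | b # _ \<Rightarrow>
        if b then C (True # take k (tl p)) else C (False # take k (tl p)))" for p
      by (cases p) auto
    have "lcomputable 1 (\<lambda>xs. C (b # take k (tl (bl_dec (xs ! 0)))))" for b
      by (rule lcomputable_comp1[OF Suc.IH, where G = "\<lambda>xs. tl (bl_dec (xs ! 0))"])
        (auto intro!: lcomputable_tl lcomputable_proj)
    then show ?case
      unfolding * by (intro lcomputable_case lcomputable_const lcomputable_proj) auto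
  qed
qed

text \<open>Since \<open>2 ^ length p\<close> is the largest power of two below \<open>Suc (bl_code p)\<close>, it is
  primitive recursive in the code of \<open>p\<close>.\<close>

fun pow2_below :: "nat \<Rightarrow> nat" where
  "pow2_below 0 = 1"
| "pow2_below (Suc n) = (if 2 * pow2_below n \<le> Suc (Suc n) then 2 * pow2_below n else pow2_below n)"

lemma pow2_below:
  "\<exists>k. pow2_below n = 2 ^ k \<and> 2 ^ k \<le> Suc n \<and> Suc n < 2 ^ Suc k"
proof (induction n)
  case (Suc n)
  then obtain k where "pow2_below n = 2 ^ k" "2 ^ k \<le> Suc n" "Suc n < 2 ^ Suc k"
    by blast
  then show ?case
    by (cases "Suc (Suc n) = 2 ^ Suc k") (auto intro: exI[of _ "Suc k"] exI[of _ k])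
qed (auto intro: exI[of _ 0])

lemma pow2_below_bl_code: "pow2_below (bl_code p) = 2 ^ length p"
proof -
  obtain k where k: "pow2_below (bl_code p) = 2 ^ k" "2 ^ k \<le> Suc (bl_code p)" "Suc (bl_code p) < 2 ^ Suc k"
    using pow2_below by blast
  then have "(2::nat) ^ k < 2 ^ Suc (length p)" "(2::nat) ^ length p < 2 ^ Suc k"
    using bl_code_bounds[of p] by linarith+
  then have "k = length p"
    by (simp add: power_strict_increasing_iff del: power_Suc)
  then show ?thesis using k by simp
qed

lemma computable_pow2_below:
  assumes "computable n F"
  shows "computable n (\<lambda>xs. pow2_below (F xs))"
proof (rule computable_rec1[where f = pow2_below and
      g = "\<lambda>y i. if 2 * y - Suc (Suc i) = 0 then 2 * y else y"])
  show "computable 2 (\<lambda>xs. if 2 * xs ! 0 - Suc (Suc (xs ! 1)) = 0 then 2 * xs ! 0 else xs ! 0)"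
    by (intro computable_if_zero computable_diff computable_Suc computable_mult
        computable_const computable_proj) auto
qed (use assms in \<open>auto simp del: One_nat_def\<close>)

lemma lcomputable_append:
  assumes "lcomputable n F" "lcomputable n G"
  shows "lcomputable n (\<lambda>xs. F xs @ G xs)"
  using assms unfolding lcomputable_def bl_code_append pow2_below_bl_code[symmetric]
  by (intro computable_add computable_mult computable_pow2_below)

section \<open>Prefix-free machines\<close>

text \<open>The shape of all machines built from \<open>U\<close> below: one run of \<open>U\<close>
  between two total maps, where the second also sees the original input. Divergence of
  \<open>U\<close> is inherited because composition needs all its arguments.\<close>

lemma partial_computable_post:
  assumes U: "partial_computable U"
    and A: "lcomputable 1 (\<lambda>xs. A (bl_dec (xs ! 0)))"
    and G: "lcomputable 2 (\<lambda>xs. G (bl_dec (xs ! 0)) (bl_dec (xs ! 1)))"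
  shows "partial_computable (\<lambda>p. map_option (G p) (U (A p)))"
proof -
  obtain f where f: "\<And>p y. U p = Some y \<longleftrightarrow> eval f [bl_code p] (bl_code y)"
    using U unfolding partial_computable_def by blast
  obtain a where "\<And>xs y. length xs = 1 \<Longrightarrow> eval a xs y \<longleftrightarrow> y = bl_code (A (bl_dec (xs ! 0)))"
    using A unfolding lcomputable_def computable_def by blast
  from this[of "[_]"] have a: "eval a [n] y \<longleftrightarrow> y = bl_code (A (bl_dec n))" for n y by simp
  obtain g where "\<And>xs y. length xs = 2 \<Longrightarrow>
      eval g xs y \<longleftrightarrow> y = bl_code (G (bl_dec (xs ! 0)) (bl_dec (xs ! 1)))"
    using G unfolding lcomputable_def computable_def by blast
  from this[of "[_, _]"] have g: "eval g [m, n] y \<longleftrightarrow> y = bl_code (G (bl_dec m) (bl_dec n))" for m n y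
    by simp
  have "map_option (G p) (U (A p)) = Some y \<longleftrightarrow>
      eval (Comp g [Proj 0, Comp f [a]]) [bl_code p] (bl_code y)" for p y
  proof -
    have 1: "eval (Comp f [a]) [bl_code p] z \<longleftrightarrow> U (A p) = Some (bl_dec z)" for z
      unfolding eval_Comp_iff f by (auto simp: length_Suc_conv a)
    have 2: "eval (Comp g [Proj 0, Comp f [a]]) [bl_code p] (bl_code y) \<longleftrightarrow>
        (\<exists>z. eval (Comp f [a]) [bl_code p] z \<and> eval g [bl_code p, z] (bl_code y))"
    proof
      assume "eval (Comp g [Proj 0, Comp f [a]]) [bl_code p] (bl_code y)"
      then show "\<exists>z. eval (Comp f [a]) [bl_code p] z \<and> eval g [bl_code p, z] (bl_code y)"
        by (subst (asm) eval_Comp_iff)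
          (auto simp: length_Suc_conv eval_Proj_iff less_Suc_eq all_conj_distrib)
    next
      assume "\<exists>z. eval (Comp f [a]) [bl_code p] z \<and> eval g [bl_code p, z] (bl_code y)"
      then obtain z where "eval (Comp f [a]) [bl_code p] z" "eval g [bl_code p, z] (bl_code y)" by blast
      then show "eval (Comp g [Proj 0, Comp f [a]]) [bl_code p] (bl_code y)"
        by (subst eval_Comp_iff)
          (auto intro!: exI[of _ "[bl_code p, z]"] simp: eval_Proj_iff less_Suc_eq)
    qed
    show ?thesis
    proof
      assume "map_option (G p) (U (A p)) = Some y"
      then obtain x where "U (A p) = Some x" "y = G p x" by auto
      then show "eval (Comp g [Proj 0, Comp f [a]]) [bl_code p] (bl_code y)"
        unfolding 1 2 by (intro exI[of _ "bl_code x"]) (simp add: g)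
    next
      assume "eval (Comp g [Proj 0, Comp f [a]]) [bl_code p] (bl_code y)"
      then show "map_option (G p) (U (A p)) = Some y"
        unfolding 1 2 by (auto simp: g)
    qed
  qed
  then show ?thesis
    unfolding partial_computable_def by blast
qed

lemma partial_computable_only_Nil: "partial_computable (\<lambda>p. if p = [] then Some [] else None)"
proof -
  \<comment> \<open>The search tests the constant function with value x, so it succeeds, at 0,
    exactly when x = 0, which is the code of the empty string.\<close>
  have "eval (Mn (Proj 1)) [x] y \<longleftrightarrow> x = 0 \<and> y = 0" for x y
    by (subst eval.simps) (auto simp: eval_Proj_iff)
  then have "(if p = [] then Some [] else None) = Some y \<longleftrightarrow> eval (Mn (Proj 1)) [bl_code p] (bl_code y)" for p y
    by (cases p; cases y) auto
  then show ?thesis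
    unfolding partial_computable_def by blast
qed

lemma universal_pf_minorizes:
  assumes "universal_pf U" "prefix_free_machine M"
  shows "\<exists>c. \<forall>p x. M p = Some x \<longrightarrow> (\<exists>q. U q = Some x \<and> length q \<le> length p + c)"
  using assms unfolding universal_pf_def by blast

text \<open>Without this the \<open>LEAST\<close> in \<open>KC\<close> would carry no information. A
  machine defined only at \<open>[]\<close> gives \<open>U\<close> a program for \<open>[]\<close>;
  replacing every output of \<open>U\<close> by x keeps the domain, hence prefix-freeness, and so
  gives \<open>U\<close> a program for x.\<close>

lemma universal_pf_total:
  assumes "universal_pf U"
  shows "\<exists>p. U p = Some x"
proof -
  have "prefix_free_machine (\<lambda>p. if p = [] then Some [] else None)"
    unfolding prefix_free_machine_def by (rule conjI[OF partial_computable_only_Nil], simp)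
  from universal_pf_minorizes[OF assms this] obtain c where
    "\<forall>(p :: bool list) x. (if p = [] then Some [] else None) = Some x \<longrightarrow> (\<exists>q. U q = Some x \<and> length q \<le> length p + c)" ..
  from spec[OF this, of "[]"] obtain q where q: "U q = Some []" by auto
  have U: "partial_computable U" "\<forall>p q. U p \<noteq> None \<longrightarrow> U q \<noteq> None \<longrightarrow> prefix p q \<longrightarrow> p = q"
    using assms unfolding universal_pf_def prefix_free_machine_def by blast+
  have "partial_computable (\<lambda>p. map_option (\<lambda>_. x) (U p))"
    by (rule partial_computable_post[of U "\<lambda>p. p" "\<lambda>_ _. x",
          OF U(1) lcomputable_proj[OF zero_less_one] lcomputable_const])
  moreover have "\<forall>p q. map_option (\<lambda>_. x) (U p) \<noteq> None \<longrightarrow> map_option (\<lambda>_. x) (U q) \<noteq> None \<longrightarrow>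
      prefix p q \<longrightarrow> p = q"
    using U(2) by (simp only: option.map_disc_iff)
  ultimately have "prefix_free_machine (\<lambda>p. map_option (\<lambda>_. x) (U p))"
    unfolding prefix_free_machine_def by (rule conjI)
  from universal_pf_minorizes[OF assms this] obtain c where
    "\<forall>p y. map_option (\<lambda>_. x) (U p) = Some y \<longrightarrow> (\<exists>q. U q = Some y \<and> length q \<le> length p + c)" ..
  then show ?thesis using q by (metis option.simps(9))
qed

text \<open>The empty string is a prefix of every program, so if it were in the domain it would be
  the only program, while \<open>U\<close> has more than one output. The block parser uses
  \<open>[]\<close> as its failure value on account of this.\<close>

lemma universal_pf_Nil:
  assumes "universal_pf U"
  shows "U [] = None"
proof (rule ccontr)
  assume *: "U [] \<noteq> None"
  obtain p q where pq: "U p = Some []" "U q = Some [True]"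
    using universal_pf_total[OF assms] by blast
  have "prefix_free_machine U" using assms by (simp add: universal_pf_def)
  then have "[] = r" if "U r \<noteq> None" for r
    using * that unfolding prefix_free_machine_def by (metis Nil_prefix)
  from this[of p] this[of q] pq show False by simp
qed

lemma KC_le: "U p = Some x \<Longrightarrow> KC U x \<le> length p"
  unfolding KC_def by (rule Least_le) blast

lemma KC_witness:
  assumes "universal_pf U"
  shows "\<exists>p. U p = Some x \<and> length p = KC U x"
  unfolding KC_def by (rule LeastI_ex) (use universal_pf_total[OF assms] in blast)

text \<open>A program \<open>True # w\<^sub>1 @ \<dots> @ True # w\<^sub>j @ False # p\<close> with \<open>length w\<^sub>i = d\<close> consists of the program
  \<open>p\<close> and the output blocks \<open>C w\<^sub>j @ \<dots> @ C w\<^sub>1\<close>. The block list comes first so that its end is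
  recognised without running the universal machine.\<close>

function blocks_rest :: "nat \<Rightarrow> bool list \<Rightarrow> bool list" where
  "blocks_rest d [] = []"
| "blocks_rest d (False # p) = p"
| "blocks_rest d (True # p) = blocks_rest d (drop d p)"
  by pat_completeness auto
termination by (relation "measure (length \<circ> snd)") auto

function blocks_out :: "nat \<Rightarrow> (bool list \<Rightarrow> bool list) \<Rightarrow> bool list \<Rightarrow> bool list" where
  "blocks_out d C [] = []"
| "blocks_out d C (False # p) = []"
| "blocks_out d C (True # p) = blocks_out d C (drop d p) @ C (take d p)"
  by pat_completeness auto
termination by (relation "measure (length \<circ> snd \<circ> snd)") auto

text \<open>One parsing step made total. It stops at the end marker or at \<open>[]\<close>, so
  iterating it too often does no harm and any bound on the number of blocks may serve as the
  iteration count.\<close>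

definition skip_block :: "nat \<Rightarrow> bool list \<Rightarrow> bool list" where
  "skip_block d p = (case p of [] \<Rightarrow> p | b # _ \<Rightarrow> if b then drop d (tl p) else p)"

lemma skip_block_simps [simp]:
  "skip_block d [] = []" "skip_block d (False # p) = False # p" "skip_block d (True # p) = drop d p"
  by (auto simp: skip_block_def)

text \<open>\<open>blocks_out\<close> recurses on strings; this version recurses on a step counter,
  as primitive recursion requires. Each new block is put in front, which explains the reversed order
  of the output blocks.\<close>

primrec collect_blocks :: "nat \<Rightarrow> (bool list \<Rightarrow> bool list) \<Rightarrow> nat \<Rightarrow> bool list \<Rightarrow> bool list" where
  "collect_blocks d C 0 p = []"
| "collect_blocks d C (Suc i) p = (let q = (skip_block d ^^ i) p in
     case q of [] \<Rightarrow> collect_blocks d C i p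
     | b # _ \<Rightarrow> if b then C (take d (tl q)) @ collect_blocks d C i p else collect_blocks d C i p)"

lemma skip_block_fixed [simp]:
  "(skip_block d ^^ i) [] = []" "(skip_block d ^^ i) (False # p) = False # p"
  by (induction i) auto

lemma blocks_rest_iterate: "length p \<le> i \<Longrightarrow> tl ((skip_block d ^^ i) p) = blocks_rest d p"
proof (induction d p arbitrary: i rule: blocks_rest.induct)
  case (3 d p)
  then show ?case
    by (cases i) (auto simp: funpow_swap1)
qed auto

lemma collect_blocks_fixed [simp]:
  "collect_blocks d C i [] = []" "collect_blocks d C i (False # p) = []"
  by (induction i) (auto simp: Let_def)

text \<open>The definition splits off the block inspected last; here the first block of the program
  is split off, to match the recursion of \<open>blocks_out\<close>.\<close>

lemma collect_blocks_Suc: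
  "collect_blocks d C (Suc i) (True # p) = collect_blocks d C i (drop d p) @ C (take d p)"
proof (induction i)
  case (Suc i)
  have shift: "(skip_block d ^^ Suc i) (True # p) = (skip_block d ^^ i) (drop d p)"
    by (simp add: funpow_swap1)
  show ?case
    unfolding collect_blocks.simps(2)[of d C "Suc i" "True # p"] shift Suc
    by (simp add: Let_def split: list.split)
qed auto

lemma blocks_out_collect: "length p \<le> i \<Longrightarrow> collect_blocks d C i p = blocks_out d C p"
proof (induction d C p arbitrary: i rule: blocks_out.induct)
  case (3 d C p)
  then obtain j where j: "i = Suc j" "length (drop d p) \<le> j"
    by (cases i) auto
  show ?case unfolding j(1) collect_blocks_Suc using 3 j(2) by simp
qed auto

lemma lcomputable_skip_blocks:
  assumes "computable n N" "lcomputable n F"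
  shows "lcomputable n (\<lambda>xs. (skip_block d ^^ N xs) (F xs))"
proof -
  have step: "lcomputable 3 (\<lambda>xs. skip_block d (bl_dec (xs ! 0)))"
    unfolding skip_block_def
    by (intro lcomputable_case lcomputable_drop lcomputable_tl lcomputable_proj) auto
  \<comment> \<open>Writing the string as the decoding of its own code turns the parameter of the
    recursion into a number.\<close>
  have "computable n (\<lambda>xs. bl_code ((skip_block d ^^ N xs) (bl_dec (bl_code (F xs)))))"
    by (rule computable_rec2[where f = "\<lambda>i x. bl_code ((skip_block d ^^ i) (bl_dec x))"
          and g = "\<lambda>y i x. bl_code (skip_block d (bl_dec y))"])
      (use assms step in \<open>auto simp: lcomputable_def intro!: computable_proj\<close>)
  then show ?thesis by (simp add: lcomputable_def)
qed

lemma lcomputable_collect_blocks: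
  assumes "computable n N" "lcomputable n F"
  shows "lcomputable n (\<lambda>xs. collect_blocks d C (N xs) (F xs))"
proof -
  define g where "g y i x = (let q = (skip_block d ^^ i) (bl_dec x) in
     case q of [] \<Rightarrow> bl_dec y | b # _ \<Rightarrow> if b then C (take d (tl q)) @ bl_dec y else bl_dec y)" for y i x
  have q: "lcomputable 3 (\<lambda>xs. (skip_block d ^^ (xs ! 1)) (bl_dec (xs ! 2)))"
    and y: "lcomputable 3 (\<lambda>xs. bl_dec (xs ! 0))"
    by (intro lcomputable_skip_blocks lcomputable_proj computable_proj; simp)+
  have "lcomputable 3 (\<lambda>xs. g (xs ! 0) (xs ! 1) (xs ! 2))"
    unfolding g_def Let_def
    by (rule lcomputable_case[OF q y
          lcomputable_append[OF lcomputable_take[OF lcomputable_tl[OF q], of C d] y] y])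
  then have g: "computable 3 (\<lambda>xs. bl_code (g (xs ! 0) (xs ! 1) (xs ! 2)))"
    by (simp add: lcomputable_def)
  have "computable n (\<lambda>xs. bl_code (collect_blocks d C (N xs) (bl_dec (bl_code (F xs)))))"
  proof (rule computable_rec2[where f = "\<lambda>i x. bl_code (collect_blocks d C i (bl_dec x))", OF _ g])
    show "computable 1 (\<lambda>xs. bl_code (collect_blocks d C 0 (bl_dec (xs ! 0))))"
      by (simp add: computable_const)
    show "bl_code (collect_blocks d C (Suc i) (bl_dec x)) =
        bl_code (g (bl_code (collect_blocks d C i (bl_dec x))) i x)" for i x
      by (simp only: g_def collect_blocks.simps(2) Let_def bl_dec_code)
    show "computable n N" "computable n (\<lambda>xs. bl_code (F xs))"
      using assms by (simp_all add: lcomputable_def)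
  qed
  then show ?thesis by (simp add: lcomputable_def)
qed

text \<open>The output \<sigma> of \<open>U\<close> is meant to be a prefix of X. Its first
  \<open>length \<rho>\<close> bits are overwritten by \<rho>, the part of Z already built, so that
  a program for X itself can be reused.\<close>

definition block_machine ::
  "(bool list \<Rightarrow> bool list option) \<Rightarrow> bool list \<Rightarrow> nat \<Rightarrow> (bool list \<Rightarrow> bool list) \<Rightarrow> bool list \<Rightarrow> bool list option"
  where "block_machine U \<rho> d C p =
    map_option (\<lambda>\<sigma>. (\<rho> @ drop (length \<rho>) \<sigma>) @ blocks_out d C p) (U (blocks_rest d p))"

text \<open>A nonempty rest shows that the end marker was read and no block was cut short, so bits
  appended to the input can only lengthen the rest.\<close>

lemma blocks_rest_append: "blocks_rest d p \<noteq> [] \<Longrightarrow> blocks_rest d (p @ u) = blocks_rest d p @ u"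
proof (induction d p rule: blocks_rest.induct)
  case (3 d p)
  then have "drop d p \<noteq> []" by (metis blocks_rest.simps(1,3))
  then show ?case using 3 by (simp add: not_le)
qed auto

lemma prefix_free_block_machine:
  assumes "universal_pf U"
  shows "prefix_free_machine (block_machine U \<rho> d C)"
  unfolding prefix_free_machine_def
proof (intro conjI allI impI)
  have U: "prefix_free_machine U" using assms by (simp add: universal_pf_def)
  have count: "length p \<le> bl_code p" for p by (rule length_le_bl_code)
  show "partial_computable (block_machine U \<rho> d C)"
    unfolding block_machine_def
  proof (rule partial_computable_post)
    show "partial_computable U" using U by (simp add: prefix_free_machine_def)
    have "lcomputable 1 (\<lambda>xs. tl ((skip_block d ^^ (xs ! 0)) (bl_dec (xs ! 0))))"
      by (intro lcomputable_tl lcomputable_skip_blocks computable_proj lcomputable_proj) auto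
    \<comment> \<open>The code of the input bounds its length and so serves as iteration count;
      \<open>tl\<close> removes the end marker.\<close>
    moreover have "tl ((skip_block d ^^ n) (bl_dec n)) = blocks_rest d (bl_dec n)" for n
      using blocks_rest_iterate[OF count[of "bl_dec n"]] by simp
    ultimately show "lcomputable 1 (\<lambda>xs. blocks_rest d (bl_dec (xs ! 0)))" by simp
    have "lcomputable 2 (\<lambda>xs. (\<rho> @ drop (length \<rho>) (bl_dec (xs ! 1))) @
        collect_blocks d C (xs ! 0) (bl_dec (xs ! 0)))"
      by (intro lcomputable_append lcomputable_drop lcomputable_collect_blocks computable_proj
          lcomputable_proj lcomputable_const) auto
    moreover have "collect_blocks d C n (bl_dec n) = blocks_out d C (bl_dec n)" for n
      using blocks_out_collect[OF count[of "bl_dec n"]] by simp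
    ultimately show "lcomputable 2 (\<lambda>xs. (\<rho> @ drop (length \<rho>) (bl_dec (xs ! 1))) @
        blocks_out d C (bl_dec (xs ! 0)))" by simp
  qed
  fix p q
  assume "block_machine U \<rho> d C p \<noteq> None" "block_machine U \<rho> d C q \<noteq> None" "prefix p q"
  then obtain u where u: "q = p @ u"
    and Up: "U (blocks_rest d p) \<noteq> None" and Uq: "U (blocks_rest d q) \<noteq> None"
    by (auto simp: block_machine_def prefix_def)
  have "blocks_rest d p \<noteq> []" using Up universal_pf_Nil[OF assms] by auto
  then have "blocks_rest d q = blocks_rest d p @ u" using blocks_rest_append u by blast
  then have "prefix (blocks_rest d p) (blocks_rest d q)" by simp
  then have "blocks_rest d p = blocks_rest d q"
    using Up Uq U unfolding prefix_free_machine_def by blast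
  then show "p = q" using \<open>blocks_rest d q = blocks_rest d p @ u\<close> u by simp
qed

section \<open>Covering codes\<close>

definition hamming :: "'a list \<Rightarrow> 'a list \<Rightarrow> nat" where
  "hamming xs ys = length (filter (\<lambda>(x, y). x \<noteq> y) (zip xs ys))"

lemma hamming_Nil [simp]: "hamming [] ys = 0"
  by (simp add: hamming_def)

lemma hamming_Cons [simp]: "hamming (x # xs) (y # ys) = (if x = y then 0 else 1) + hamming xs ys"
  by (simp add: hamming_def)

lemma hamming_append:
  "length xs = length ys \<Longrightarrow> hamming (xs @ xs') (ys @ ys') = hamming xs ys + hamming xs' ys'"
  by (simp add: hamming_def zip_append)

lemma hamming_le_length: "hamming xs ys \<le> length xs"
  unfolding hamming_def by (metis length_filter_le length_zip min.boundedE)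

text \<open>Splitting by agreement in the first bit is Pascal's rule.\<close>

lemma card_hamming_sphere:
  "card {z :: bool list. length z = length v \<and> hamming v z = k} = length v choose k"
proof (induction v arbitrary: k)
  case Nil
  then show ?case by (cases k) auto
next
  case (Cons b v)
  let ?S = "\<lambda>k. {z :: bool list. length z = length v \<and> hamming v z = k}"
  have fin: "finite (?S k)" for k
    by (rule finite_subset[OF _ finite_lists_length_eq[of UNIV "length v"]]) auto
  have inj: "card ((#) c ` A) = card A" for c :: bool and A
    by (rule card_image) auto
  show ?case
  proof (cases k)
    case 0
    have "{z. length z = length (b # v) \<and> hamming (b # v) z = k} = (#) b ` ?S 0"
      by (auto simp: 0 length_Suc_conv split: if_splits)
    then show ?thesis using Cons.IH[of 0] by (simp add: inj 0)
  next
    case (Suc j)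
    have "{z. length z = length (b # v) \<and> hamming (b # v) z = k} =
        (#) b ` ?S (Suc j) \<union> (#) (\<not> b) ` ?S j"
      by (auto simp: Suc length_Suc_conv image_iff split: if_splits)
    also have "card \<dots> = card (?S (Suc j)) + card (?S j)"
      by (subst card_Un_disjoint) (use fin inj in auto)
    finally show ?thesis using Cons.IH by (simp add: Suc)
  qed
qed

text \<open>Each greedy step covers at least the average share of the points still uncovered.\<close>

lemma greedy_cover:
  fixes R :: "'a \<Rightarrow> 'a \<Rightarrow> bool"
  assumes "finite A" and ne: "A \<noteq> {}" and ball: "\<And>x. x \<in> A \<Longrightarrow> V \<le> card {z \<in> A. R x z}"
  shows "\<exists>S\<subseteq>A. card S \<le> K \<and>
    real (card {x \<in> A. \<forall>z\<in>S. \<not> R x z}) \<le> real (card A) * (1 - real V / card A) ^ K"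
proof (induction K)
  case 0
  have "card {x \<in> A. \<forall>z\<in>{}. \<not> R x z} = card A" by simp
  then show ?case by (intro exI[of _ "{}"]) simp
next
  case (Suc K)
  obtain S where S: "S \<subseteq> A" "card S \<le> K"
    "real (card {x \<in> A. \<forall>z\<in>S. \<not> R x z}) \<le> real (card A) * (1 - real V / card A) ^ K"
    using Suc.IH by blast
  define U where "U = {x \<in> A. \<forall>z\<in>S. \<not> R x z}"
  have fU: "finite U" and UA: "U \<subseteq> A" using \<open>finite A\<close> by (auto simp: U_def)
  have cA: "card A > 0" using assms by (simp add: card_gt_0_iff)
  \<comment> \<open>Related pairs of an uncovered point and a possible centre are counted in both
    orders; some centre then attains the average.\<close>
  have "V * card U \<le> (\<Sum>x\<in>U. card {z \<in> A. R x z})"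
    using sum_mono[of U "\<lambda>_. V" "\<lambda>x. card {z \<in> A. R x z}"] ball UA by (auto simp: mult.commute)
  also have "\<dots> = (\<Sum>z\<in>A. card {x \<in> U. R x z})"
    using sum.swap_restrict[OF fU \<open>finite A\<close>, of "\<lambda>_ _. 1::nat" R] by simp
  finally have avg: "V * card U \<le> (\<Sum>z\<in>A. card {x \<in> U. R x z})" .
  have "\<exists>z\<in>A. V * card U \<le> card A * card {x \<in> U. R x z}"
  proof (rule ccontr)
    assume "\<not> ?thesis"
    then have "(\<Sum>z\<in>A. card A * card {x \<in> U. R x z}) < (\<Sum>z\<in>A. V * card U)"
      using assms by (intro sum_strict_mono) (auto simp: not_le)
    then have "card A * (\<Sum>z\<in>A. card {x \<in> U. R x z}) < card A * (V * card U)"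
      by (simp add: sum_distrib_left)
    then show False using avg cA by simp
  qed
  then obtain z where z: "z \<in> A" "V * card U \<le> card A * card {x \<in> U. R x z}" by blast
  have ge: "real V / card A * card U \<le> card {x \<in> U. R x z}"
    using z(2) cA by (simp add: field_simps flip: of_nat_mult)
  have "card U = card {x \<in> U. R x z} + card {x \<in> U. \<not> R x z}"
    using fU by (subst card_Un_disjoint[symmetric]) (auto intro: arg_cong[where f = card])
  then have "real (card {x \<in> U. \<not> R x z}) \<le> (1 - real V / card A) * card U"
    using ge by (simp add: algebra_simps)
  also have "\<dots> \<le> (1 - real V / card A) * (real (card A) * (1 - real V / card A) ^ K)"
  proof (rule mult_left_mono)
    obtain x where x: "x \<in> A" using ne by blast
    have "V \<le> card A"
      using ball[OF x] card_mono[OF \<open>finite A\<close>, of "{z \<in> A. R x z}"] by force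
    then show "0 \<le> 1 - real V / real (card A)" using cA by (simp add: field_simps)
  qed (use S in \<open>simp add: U_def\<close>)
  finally have "real (card {x \<in> U. \<not> R x z}) \<le> real (card A) * (1 - real V / card A) ^ Suc K"
    by (simp add: algebra_simps)
  moreover have "{x \<in> U. \<not> R x z} = {x \<in> A. \<forall>z\<in>insert z S. \<not> R x z}"
    by (auto simp: U_def)
  moreover have "card (insert z S) \<le> Suc K"
    using S(2) card_insert_le[of S z] by (cases "finite S") (auto simp: card_insert_if)
  ultimately show ?case
    using S z(1) by (intro exI[of _ "insert z S"]) auto
qed

section \<open>The entropy bound for binomial coefficients\<close>

lemma binomial_term_mode:
  fixes L k j :: nat
  assumes "0 < k" "k < L" "j \<le> L"
  defines "p \<equiv> real k / L"
  shows "real (L choose j) * p ^ j * (1 - p) ^ (L - j) \<le> real (L choose k) * p ^ k * (1 - p) ^ (L - k)"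
proof -
  define T where "T j = real (L choose j) * p ^ j * (1 - p) ^ (L - j)" for j
  have p: "0 < p" "p < 1" using assms by (auto simp: p_def)
  have pL: "p * L = k" using assms by (simp add: p_def)
  \<comment> \<open>The ratio of consecutive terms, written without division. It is at least 1 iff j
    + 1 \<le> p (L + 1), and p L = k, so the terms rise up to k and fall afterwards.\<close>
  have step: "T (Suc j) * (real (Suc j) * (1 - p)) = T j * (real (L - j) * p)" if "j < L" for j
  proof -
    have "Suc j * (L choose Suc j) = (L - j) * (L choose j)"
      by (simp only: binomial_absorption binomial_absorb_comp)
    then have "real (Suc j) * real (L choose Suc j) = real (L - j) * real (L choose j)"
      by (metis of_nat_mult)
    moreover have "(1 - p) ^ (L - j) = (1 - p) ^ (L - Suc j) * (1 - p)"
      using that by (metis Suc_diff_Suc power_Suc2)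
    ultimately show ?thesis
      unfolding T_def power_Suc by (metis mult.assoc mult.commute mult.left_commute)
  qed
  have T0: "0 \<le> T j" for j using p by (simp add: T_def)
  have up: "T j \<le> T (Suc j)" if "j < k" for j
  proof -
    have "real (Suc j) * (1 - p) \<le> real (L - j) * p"
    proof -
      have "real (Suc j) \<le> k" using that by simp
      then have "real (Suc j) \<le> p * L + p" using p pL by linarith
      then show ?thesis using that \<open>k < L\<close> by (simp add: of_nat_diff algebra_simps)
    qed
    then have "T j * (real (Suc j) * (1 - p)) \<le> T (Suc j) * (real (Suc j) * (1 - p))"
      using step[of j] that \<open>k < L\<close> T0[of j] by (metis mult_left_mono order.strict_trans)
    then show ?thesis using p by (simp add: mult_le_cancel_right)
  qed
  have down: "T (Suc j) \<le> T j" if "k \<le> j" "j < L" for j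
  proof -
    have "real (L - j) * p \<le> real (Suc j) * (1 - p)"
    proof -
      have "k \<le> real j" using that by simp
      then have "p * L + p \<le> real (Suc j)" using p pL by simp
      then show ?thesis using that \<open>k < L\<close> by (simp add: of_nat_diff algebra_simps)
    qed
    then have "T (Suc j) * (real (L - j) * p) \<le> T j * (real (L - j) * p)"
      using step[of j] that T0[of "Suc j"] by (metis mult_left_mono)
    then show ?thesis using p that by (simp add: mult_le_cancel_right)
  qed
  have "T j \<le> T k"
  proof (cases "j \<le> k")
    case True
    then show ?thesis
      by (induction rule: inc_induct) (use up in \<open>auto intro: order_trans\<close>)
  next
    case False
    then have "k \<le> j" by simp
    then show ?thesis using \<open>j \<le> L\<close>
    proof (induction rule: dec_induct)
      case (step n)
      then show ?case using down[of n] by simp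
    qed simp
  qed
  then show ?thesis by (simp add: T_def)
qed

text \<open>The L + 1 terms of (p + (1 - p))^L sum to 1, so the largest, at k, is at least 1 / (L +
  1).\<close>

lemma log_binomial_ge:
  assumes "0 < k" "k < L"
  shows "log 2 (real (L choose k)) \<ge> L * bin_entropy (real k / L) - log 2 (real L + 1)"
proof -
  define p where "p = real k / L"
  have p: "0 < p" "p < 1" using assms by (auto simp: p_def)
  have kL: "real k = p * L" "real (L - k) = (1 - p) * L"
    using assms by (auto simp: p_def of_nat_diff field_simps)
  have "1 = (p + (1 - p)) ^ L" by simp
  also have "\<dots> = (\<Sum>j\<le>L. real (L choose j) * p ^ j * (1 - p) ^ (L - j))"
    by (subst binomial_ring) simp
  also have "\<dots> \<le> (\<Sum>j\<le>L. real (L choose k) * p ^ k * (1 - p) ^ (L - k))"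
    unfolding p_def by (intro sum_mono binomial_term_mode) (use assms in auto)
  also have "\<dots> = (real L + 1) * (real (L choose k) * p ^ k * (1 - p) ^ (L - k))"
    by simp
  finally have "log 2 1 \<le> log 2 ((real L + 1) * (real (L choose k) * p ^ k * (1 - p) ^ (L - k)))"
    using p assms by (subst log_le_cancel_iff) auto
  also have "\<dots> = log 2 (real L + 1) + log 2 (real (L choose k)) + k * log 2 p + (L - k) * log 2 (1 - p)"
    using p assms by (simp add: log_mult log_nat_power)
  finally show ?thesis
    unfolding p_def[symmetric] bin_entropy_def using kL by (simp add: algebra_simps)
qed

text \<open>The rate condition says V 2^d / 2^L \<ge> L. After 2^d greedy choices the uncovered
  fraction is at most exp(-L) < 2^(-L), which is less than one word. The sphere of radius k already
  supplies enough points of the ball.\<close>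

lemma covering_code_exists:
  assumes "L > 0"
    and rate: "real d \<ge> L - log 2 (real (L choose k)) + log 2 L" and k: "k \<le> L"
  shows "\<exists>C. (\<forall>w. length (C w) = L) \<and>
     (\<forall>v :: bool list. length v = L \<longrightarrow> (\<exists>w :: bool list. length w = d \<and> hamming v (C w) \<le> k))"
proof -
  define A where "A = {z :: bool list. length z = L}"
  define V where "V = L choose k"
  have finA: "finite A" and cardA: "card A = 2 ^ L"
    using finite_lists_length_eq[of "UNIV :: bool set" L] card_lists_length_eq[of "UNIV :: bool set" L]
    by (auto simp: A_def)
  have neA: "A \<noteq> {}" using cardA by force
  have V: "V > 0" using k by (simp add: V_def)
  have "V \<le> card {z \<in> A. hamming x z \<le> k}" if "x \<in> A" for x
  proof -
    have "V = card {z. length z = length x \<and> hamming x z = k}"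
      using that unfolding card_hamming_sphere by (simp add: V_def A_def)
    also have "\<dots> \<le> card {z \<in> A. hamming x z \<le> k}"
      using finA that by (intro card_mono) (auto simp: A_def)
    finally show ?thesis .
  qed
  then obtain S where S: "S \<subseteq> A" "card S \<le> 2 ^ d"
    "real (card {x \<in> A. \<forall>z\<in>S. \<not> hamming x z \<le> k}) \<le> real (card A) * (1 - real V / card A) ^ (2 ^ d)"
    using greedy_cover[OF finA neA, of V "\<lambda>x z. hamming x z \<le> k" "2 ^ d"] by blast
  have "real V / 2 ^ L * 2 ^ d \<ge> L"
  proof -
    have "log 2 L \<le> log 2 (real V) - L + d" using rate by (simp add: V_def)
    also have "\<dots> = log 2 (real V / 2 ^ L * 2 ^ d)"
      using V by (simp add: log_mult log_divide log_nat_power)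
    finally show ?thesis using V \<open>L > 0\<close> by (subst (asm) log_le_cancel_iff) auto
  qed
  then have "exp (- (real V / 2 ^ L)) ^ (2 ^ d) \<le> exp (- real L)"
    by (simp add: exp_of_nat_mult[symmetric] mult.commute)
  moreover have "exp (real L) > 2 ^ L"
  proof -
    have "(2::real) < exp 1" using exp_less_mono[OF ln_2_less_1] by simp
    then show ?thesis
      using \<open>L > 0\<close> power_strict_mono[of "2::real" "exp 1" L] by (simp add: exp_of_nat_mult[symmetric])
  qed
  moreover have "(1 - real V / card A) ^ (2 ^ d) \<le> exp (- (real V / 2 ^ L)) ^ (2 ^ d)"
  proof (rule power_mono)
    show "1 - real V / card A \<le> exp (- (real V / 2 ^ L))"
      using exp_ge_add_one_self[of "- (real V / 2 ^ L)"] by (simp add: cardA)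
    have "V \<le> 2 ^ L" unfolding V_def
      by (metis binomial_le_pow2)
    then have "real V \<le> 2 ^ L" by (metis of_nat_le_iff of_nat_numeral of_nat_power)
    then show "0 \<le> 1 - real V / card A" by (simp add: cardA)
  qed
  ultimately have "(1 - real V / card A) ^ (2 ^ d) < 1 / 2 ^ L"
    using less_imp_inverse_less[of "2 ^ L" "exp (real L)"] by (simp add: exp_minus inverse_eq_divide)
  then have "real (card A) * (1 - real V / card A) ^ (2 ^ d) < 1"
    by (simp add: cardA pos_less_divide_eq mult.commute)
  then have "card {x \<in> A. \<forall>z\<in>S. \<not> hamming x z \<le> k} = 0"
    using S(3) by linarith
  then have cov: "\<And>x. x \<in> A \<Longrightarrow> \<exists>z\<in>S. hamming x z \<le> k"
    using finA by auto
  have "card {w :: bool list. length w = d} = 2 ^ d" "finite {w :: bool list. length w = d}"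
    using finite_lists_length_eq[of "UNIV :: bool set" d] card_lists_length_eq[of "UNIV :: bool set" d]
    by auto
  then obtain f where f: "f ` S \<subseteq> {w :: bool list. length w = d}" "inj_on f S"
    using card_le_inj[of S "{w :: bool list. length w = d}"] S finite_subset[OF S(1) finA] by auto
  obtain a where a: "a \<in> A" using neA by blast
  define C where "C w = (if w \<in> f ` S then inv_into S f w else a)" for w
  have "C w \<in> A" for w
    using a S(1) by (auto simp: C_def inv_into_into)
  moreover have "\<exists>w. length w = d \<and> hamming v (C w) \<le> k" if v: "v \<in> A" for v
  proof -
    obtain z where z: "z \<in> S" "hamming v z \<le> k" using cov[OF v] by blast
    then show ?thesis using f by (intro exI[of _ "f z"]) (auto simp: C_def)
  qed
  ultimately show ?thesis by (intro exI[of _ C]) (auto simp: A_def)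
qed

text \<open>The clause \<open>1 \<le> \<eta> * L\<close> will pay for the marker bit in front of
  each block.\<close>

lemma covering_code:
  fixes c \<eta> :: real
  assumes c: "0 < c" "c < 1" and "\<eta> > 0"
  shows "\<exists>L d C. L > 0 \<and> 1 \<le> \<eta> * L \<and> real d \<le> L * (1 - bin_entropy c + \<eta>) \<and>
     (\<forall>w. length (C w) = L) \<and>
     (\<forall>v :: bool list. length v = L \<longrightarrow> (\<exists>w :: bool list. length w = d \<and> real (hamming v (C w)) \<le> c * L))"
proof -
  define k where "k L = nat \<lfloor>c * real L\<rfloor>" for L
  have kc: "(\<lambda>L. real (k L) / real L) \<longlonglongrightarrow> c"
    unfolding k_def using c by real_asymp
  have ent: "(\<lambda>L. bin_entropy (real (k L) / real L)) \<longlonglongrightarrow> bin_entropy c"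
    unfolding bin_entropy_def by (intro tendsto_intros kc) (use c in auto)
  \<comment> \<open>The three losses per bit: the entropy estimate, the factor L in the covering
    condition, and rounding d up.\<close>
  have "(\<lambda>L. log 2 (real L + 1) / L + log 2 L / L + 1 / L) \<longlonglongrightarrow> 0"
    by real_asymp
  from tendsto_add[OF tendsto_diff[OF tendsto_const[of 1] ent] this]
  have "(\<lambda>L. 1 - bin_entropy (real (k L) / real L) + (log 2 (real L + 1) / L + log 2 L / L + 1 / L))
     \<longlonglongrightarrow> 1 - bin_entropy c" by simp
  then have 1: "\<forall>\<^sub>F L in sequentially. 1 - bin_entropy (real (k L) / real L) +
      (log 2 (real L + 1) / L + log 2 L / L + 1 / L) < 1 - bin_entropy c + \<eta>"
    using \<open>\<eta> > 0\<close> by (intro order_tendstoD(2)) auto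
  have 2: "\<forall>\<^sub>F L in sequentially. real (k L) / real L > 0"
    "\<forall>\<^sub>F L in sequentially. real (k L) / real L < 1"
    using order_tendstoD[OF kc] c by auto
  have 3: "\<forall>\<^sub>F L in sequentially. 1 \<le> \<eta> * real L"
    using \<open>\<eta> > 0\<close> by real_asymp
  obtain L where L: "1 - bin_entropy (real (k L) / real L) +
      (log 2 (real L + 1) / L + log 2 L / L + 1 / L) < 1 - bin_entropy c + \<eta>"
    "real (k L) / real L > 0" "real (k L) / real L < 1" "1 \<le> \<eta> * real L"
    using eventually_happens[OF eventually_conj[OF 1 eventually_conj[OF 2(1) eventually_conj[OF 2(2) 3]]]]
    by auto
  have kL: "0 < k L" "k L < L" "0 < L" using L(2,3) by (auto simp: zero_less_divide_iff divide_less_eq_1)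
  define y where "y = L - log 2 (real (L choose k L)) + log 2 L"
  define d where "d = nat \<lceil>y\<rceil>"
  \<comment> \<open>This makes y nonnegative, so \<open>nat\<close> does not truncate.\<close>
  have "log 2 (real (L choose k L)) \<le> L"
  proof -
    have "real (L choose k L) \<le> 2 ^ L"
      by (metis binomial_le_pow2 of_nat_le_iff of_nat_numeral of_nat_power)
    then have "log 2 (real (L choose k L)) \<le> log 2 (2 ^ L)"
      using kL by (subst log_le_cancel_iff) auto
    then show ?thesis by (simp add: log_nat_power)
  qed
  then have "y \<ge> 0" using kL by (simp add: y_def)
  then have l: "real d \<ge> y" "real d \<le> y + 1" unfolding d_def by linarith+
  obtain C where C: "\<forall>w. length (C w) = L"
     "\<forall>v :: bool list. length v = L \<longrightarrow> (\<exists>w :: bool list. length w = d \<and> hamming v (C w) \<le> k L)"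
    using covering_code_exists[of L "k L" d] l(1) kL by (auto simp: y_def)
  have "real d \<le> L - L * bin_entropy (real (k L) / L) + log 2 (real L + 1) + log 2 L + 1"
    using l(2) log_binomial_ge[OF kL(1,2)] by (simp add: y_def)
  also have "\<dots> = L * (1 - bin_entropy (real (k L) / real L) +
      (log 2 (real L + 1) / L + log 2 L / L + 1 / L))"
    using kL by (simp add: field_simps)
  also have "\<dots> \<le> L * (1 - bin_entropy c + \<eta>)"
    using L(1) by (intro mult_left_mono) auto
  finally have "real d \<le> L * (1 - bin_entropy c + \<eta>)" .
  moreover have "\<exists>w. length w = d \<and> real (hamming v (C w)) \<le> c * L" if v: "length v = L" for v
  proof -
    obtain w where "length w = d" "hamming v (C w) \<le> k L" using C(2) v by blast
    moreover have "real (k L) \<le> c * L" using c by (simp add: k_def)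
    ultimately show ?thesis by (intro exI[of _ w]) linarith
  qed
  ultimately show ?thesis
    using L(4) kL(3) C(1) by blast
qed

section \<open>Lowering the dimension\<close>

text \<open>A new block goes to the front of the program and the end of the output. The extra L in
  the bound for prefixes allows for a cut inside a block, whose changes may all lie before the
  cut.\<close>

lemma block_program:
  fixes c :: real
  assumes len: "\<And>w. length (C w) = L" and "0 \<le> c"
    and cov: "\<And>v. length v = L \<Longrightarrow> \<exists>w. length w = d \<and> real (hamming v (C w)) \<le> c * L"
  shows "length v = j * L \<Longrightarrow> \<exists>P \<tau>. length P = j * Suc d \<and> length \<tau> = j * L \<and>
    (\<forall>u. blocks_rest d (P @ False # u) = u \<and> blocks_out d C (P @ False # u) = \<tau>) \<and>
    real (hamming v \<tau>) \<le> c * (j * L) \<and>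
    (\<forall>N \<le> j * L. real (hamming (take N v) (take N \<tau>)) \<le> c * N + L)"
proof (induction j arbitrary: v)
  case 0
  then show ?case by simp
next
  case (Suc j)
  define v0 b where "v0 = take (j * L) v" and "b = drop (j * L) v"
  have v: "v = v0 @ b" "length v0 = j * L" "length b = L"
    using Suc.prems by (simp_all add: v0_def b_def)
  obtain P \<tau> where P: "length P = j * Suc d" "length \<tau> = j * L"
    "\<And>u. blocks_rest d (P @ False # u) = u" "\<And>u. blocks_out d C (P @ False # u) = \<tau>"
    "real (hamming v0 \<tau>) \<le> c * (j * L)"
    "\<And>N. N \<le> j * L \<Longrightarrow> real (hamming (take N v0) (take N \<tau>)) \<le> c * N + L"
    using Suc.IH[OF v(2)] by blast
  obtain w where w: "length w = d" "real (hamming b (C w)) \<le> c * L"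
    using cov[OF v(3)] by blast
  have part: "real (hamming (take N v) (take N (\<tau> @ C w))) \<le> c * N + L" if "N \<le> Suc j * L" for N
  proof (cases "N \<le> j * L")
    case True
    then show ?thesis using P(2,6) v by simp
  next
    case False
    then have "hamming (take N v) (take N (\<tau> @ C w)) =
        hamming v0 \<tau> + hamming (take (N - j * L) b) (take (N - j * L) (C w))"
      using P(2) v by (simp add: hamming_append)
    moreover have "hamming (take (N - j * L) b) (take (N - j * L) (C w)) \<le> L"
      using hamming_le_length[of "take (N - j * L) b" "take (N - j * L) (C w)"] v(3) by simp
    moreover have "c * (j * L) \<le> c * N"
    proof (rule mult_left_mono)
      show "real (j * L) \<le> real N" using False by (intro of_nat_mono) simp
    qed (rule \<open>0 \<le> c\<close>)
    ultimately show ?thesis using P(5) by simp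
  qed
  have "real (hamming v (\<tau> @ C w)) \<le> c * (Suc j * L)"
    using P(2,5) w(2) v len by (simp add: hamming_append algebra_simps)
  moreover have "blocks_rest d ((True # w @ P) @ False # u) = u"
    "blocks_out d C ((True # w @ P) @ False # u) = \<tau> @ C w" for u
    using P(3,4) w(1) by simp_all
  moreover have "length (True # w @ P) = Suc j * Suc d" using P(1) w(1) by simp
  moreover have "length (\<tau> @ C w) = Suc j * L" using P(2) len by simp
  ultimately show ?case using part by blast
qed

text \<open>The order of quantifiers is the point: the constant depends on \<rho>, d and
  \<open>C\<close>, but not on \<sigma> or the number of blocks.\<close>

lemma KC_block_program:
  assumes "universal_pf U"
  shows "\<exists>K. \<forall>\<sigma> P \<tau>. (\<forall>u. blocks_rest d (P @ False # u) = u \<and> blocks_out d C (P @ False # u) = \<tau>) \<longrightarrow>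
    KC U ((\<rho> @ drop (length \<rho>) \<sigma>) @ \<tau>) \<le> KC U \<sigma> + length P + K"
proof -
  obtain K where K: "\<forall>p x. block_machine U \<rho> d C p = Some x \<longrightarrow> (\<exists>q. U q = Some x \<and> length q \<le> length p + K)"
    using universal_pf_minorizes[OF assms prefix_free_block_machine[OF assms]] ..
  \<comment> \<open>\<open>Suc\<close> accounts for the end marker.\<close>
  have "KC U ((\<rho> @ drop (length \<rho>) \<sigma>) @ \<tau>) \<le> KC U \<sigma> + length P + Suc K"
    if P: "\<forall>u. blocks_rest d (P @ False # u) = u \<and> blocks_out d C (P @ False # u) = \<tau>" for \<sigma> P \<tau>
  proof -
    obtain p where p: "U p = Some \<sigma>" "length p = KC U \<sigma>"
      using KC_witness[OF assms] by blast
    have "block_machine U \<rho> d C (P @ False # p) = Some ((\<rho> @ drop (length \<rho>) \<sigma>) @ \<tau>)"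
      using P p by (simp add: block_machine_def)
    then obtain q where "U q = Some ((\<rho> @ drop (length \<rho>) \<sigma>) @ \<tau>)" "length q \<le> length (P @ False # p) + K"
      using K by blast
    then show ?thesis using KC_le[of U q] p(2) by fastforce
  qed
  then show ?thesis by blast
qed

lemma hamming_refl [simp]: "hamming xs xs = 0"
  by (induction xs) auto

lemma hamming_prefix_of:
  "length ys = N \<Longrightarrow> hamming (prefix_of X N) ys = card {m. m < N \<and> X m \<noteq> ys ! m}"
  unfolding hamming_def prefix_of_def length_filter_conv_card
  by (intro arg_cong[where f = card]) auto

lemma prefix_of_split: "m \<le> n \<Longrightarrow> prefix_of X n = prefix_of X m @ map X [m..<n]"
  unfolding prefix_of_def by (metis map_append upt_add_eq_append le_add_diff_inverse zero_le)

lemma length_prefix_of [simp]: "length (prefix_of X n) = n"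
  by (simp add: prefix_of_def)

lemma frequently_KC_le:
  fixes s \<eta> :: real
  assumes "eff_dim U X = ereal s" "0 < \<eta>"
  shows "\<exists>n\<ge>N. KC U (prefix_of X n) \<le> (s + \<eta>) * n"
proof (rule ccontr)
  assume "\<not> ?thesis"
  then have *: "KC U (prefix_of X n) > (s + \<eta>) * n" if "n \<ge> N" for n using that by force
  have "ereal (s + \<eta>) \<le> eff_dim U X"
    unfolding eff_dim_def
  proof (rule Liminf_bounded, rule eventually_sequentiallyI[of "Suc N"])
    fix n assume "Suc N \<le> n"
    then show "ereal (s + \<eta>) \<le> ereal (real (KC U (prefix_of X n)) / real n)"
      using *[of n] by (simp add: field_simps)
  qed
  then show False using assms by simp
qed

text \<open>Two tolerances drive the iteration: the distance stays within the old \<epsilon>'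
  throughout the extension and is within the new \<epsilon> at its end, since a large n dilutes the
  changes made in \<rho>.\<close>

lemma extension_step:
  fixes X :: "nat \<Rightarrow> bool" and s t c \<epsilon> \<epsilon>' :: real
  defines "h \<equiv> 1 - bin_entropy c"
  defines "B \<equiv> c * ((s - t) / (s - h))"
  assumes U: "universal_pf U" and X: "eff_dim U X = ereal s"
    and c: "0 < c" "c < 1" and t: "h < t" "t < s" and \<epsilon>: "0 < \<epsilon>" "\<epsilon> \<le> \<epsilon>'"
    and \<rho>: "real (hamming (prefix_of X (length \<rho>)) \<rho>) \<le> (B + \<epsilon>') * length \<rho>"
  shows "\<exists>\<rho>'. prefix \<rho> \<rho>' \<and> length \<rho> < length \<rho>' \<and> real (KC U \<rho>') \<le> (t + \<epsilon>) * length \<rho>' \<and>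
    real (hamming (prefix_of X (length \<rho>')) \<rho>') \<le> (B + \<epsilon>) * length \<rho>' \<and>
    (\<forall>N. length \<rho> \<le> N \<longrightarrow> N \<le> length \<rho>' \<longrightarrow> real (hamming (prefix_of X N) (take N \<rho>')) \<le> (B + \<epsilon>') * N)"
proof -
  \<comment> \<open>One quarter each for K(X|n), the rate of the code, the marker bits and the
    additive constants.\<close>
  define \<eta> where "\<eta> = \<epsilon> / 4"
  have "\<eta> > 0" using \<epsilon> by (simp add: \<eta>_def)
  obtain L d C where L: "L > 0" "1 \<le> \<eta> * L" "real d \<le> L * (h + \<eta>)" "\<And>w. length (C w) = L"
    and cov: "\<And>v :: bool list. length v = L \<Longrightarrow> \<exists>w :: bool list. length w = d \<and> real (hamming v (C w)) \<le> c * L"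
    using covering_code[OF c \<open>\<eta> > 0\<close>] unfolding h_def by blast
  obtain K where K: "\<And>\<sigma> P \<tau>. (\<forall>u. blocks_rest d (P @ False # u) = u \<and> blocks_out d C (P @ False # u) = \<tau>) \<Longrightarrow>
    KC U ((\<rho> @ drop (length \<rho>) \<sigma>) @ \<tau>) \<le> KC U \<sigma> + length P + K"
    using KC_block_program[OF U] by blast
  \<comment> \<open>The segment relative to n instead of its end: s + h \<mu> = t (1 + \<mu>), and
    \<mu> / (1 + \<mu>) is lambda.\<close>
  define \<mu> where "\<mu> = (s - t) / (t - h)"
  have \<mu>: "\<mu> > 0" "(t - h) * \<mu> = s - t" and B: "B * (1 + \<mu>) = c * \<mu>"
    using t by (auto simp: \<mu>_def B_def divide_simps)
  have "B > 0" using c t by (simp add: B_def)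
  obtain N0 :: nat where N0: "real N0 \<ge> (length \<rho> + L + (t - h) * L + K + 1) / \<eta>" "N0 > length \<rho>"
    using real_arch_simple[of "max ((length \<rho> + L + (t - h) * L + K + 1) / \<eta>) (real (Suc (length \<rho>)))"] by auto
  obtain n where n: "n \<ge> N0" "KC U (prefix_of X n) \<le> (s + \<eta>) * n"
    using frequently_KC_le[OF X \<open>\<eta> > 0\<close>] by blast
  have n\<rho>: "length \<rho> < n" using n N0 by simp
  have big: "\<eta> * n \<ge> length \<rho> + L + (t - h) * L + K + 1"
  proof -
    have "(length \<rho> + L + (t - h) * L + K + 1) / \<eta> \<le> n" using n N0 by linarith
    then show ?thesis using \<open>\<eta> > 0\<close> by (simp add: divide_le_eq mult.commute)
  qed
  have tL: "(t - h) * L \<ge> 0" using t by simp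
  \<comment> \<open>Rounding down keeps the changes within c \<mu> n and loses less than one block,
    which costs at most (t - h) L in complexity.\<close>
  define j where "j = nat \<lfloor>\<mu> * n / L\<rfloor>"
  have "real j \<le> \<mu> * n / L" "\<mu> * n / L - 1 < real j"
    using \<mu> unfolding j_def by (simp, linarith)
  then have j: "real j * L \<le> \<mu> * n" "\<mu> * n - L < real j * L"
    using L(1) by (simp_all add: field_simps)
  define v where "v = map X [n..<n + j * L]"
  have "length v = j * L" by (simp add: v_def)
  from block_program[OF L(4) less_imp_le[OF c(1)] cov this] obtain P \<tau> where P: "length P = j * Suc d" "length \<tau> = j * L"
    "\<forall>u. blocks_rest d (P @ False # u) = u \<and> blocks_out d C (P @ False # u) = \<tau>"
    "\<And>N. N \<le> j * L \<Longrightarrow> real (hamming (take N v) (take N \<tau>)) \<le> c * N + L"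
    by blast
  define \<kappa> where "\<kappa> = \<rho> @ drop (length \<rho>) (prefix_of X n)"
  have len\<kappa>: "length \<kappa> = n" using n\<rho> by (simp add: \<kappa>_def)
  define \<rho>' where "\<rho>' = \<kappa> @ \<tau>"
  have len: "length \<rho>' = n + j * L" by (simp add: \<rho>'_def len\<kappa> P(2))
  have KC: "real (KC U \<rho>') \<le> (t + \<epsilon>) * length \<rho>'"
  proof -
    have "real (KC U \<rho>') \<le> real (KC U (prefix_of X n) + length P + K)"
      unfolding \<rho>'_def \<kappa>_def by (intro of_nat_mono K[OF P(3)])
    then have "real (KC U \<rho>') \<le> (s + \<eta>) * n + j * (real d + 1) + K"
      using n(2) P(1) by (simp add: algebra_simps)
    also have "\<dots> \<le> (s + \<eta>) * n + j * (L * (h + 2 * \<eta>)) + K"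
    proof -
      have "real d + 1 \<le> L * (h + 2 * \<eta>)" using L(2,3) by (simp add: algebra_simps)
      then show ?thesis by (simp add: mult_left_mono)
    qed
    also have "\<dots> \<le> (t + \<epsilon>) * (n + j * L)"
    proof -
      have "(t - h) * (real j * L) \<ge> (t - h) * (\<mu> * n - L)"
        using j(2) t by (intro mult_left_mono) auto
      then have "(t - h) * (real j * L) \<ge> (s - t) * n - (t - h) * L"
        using \<mu>(2) by (simp add: right_diff_distrib flip: mult.assoc)
      moreover have "\<eta> * (real j * L) \<ge> 0" "\<eta> * n \<ge> 0" using \<open>\<eta> > 0\<close> by simp_all
      moreover have "\<epsilon> = 4 * \<eta>" by (simp add: \<eta>_def)
      ultimately show ?thesis using big by (simp add: algebra_simps)
    qed
    finally show ?thesis by (simp add: len)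
  qed
  \<comment> \<open>No bit between the end of \<rho> and n is changed, so the old bound persists as
    N grows.\<close>
  have low: "real (hamming (prefix_of X N) (take N \<rho>')) \<le> (B + \<epsilon>') * N"
    if N: "length \<rho> \<le> N" "N \<le> n" for N
  proof -
    have "drop (length \<rho>) (prefix_of X n) = map X [length \<rho>..<n]"
      by (simp add: prefix_of_def drop_map)
    then have "take N \<rho>' = \<rho> @ map X [length \<rho>..<N]"
      using N n\<rho> by (simp add: \<rho>'_def \<kappa>_def take_map)
    then have "hamming (prefix_of X N) (take N \<rho>') = hamming (prefix_of X (length \<rho>)) \<rho>"
      by (simp add: prefix_of_split[OF N(1)] hamming_append)
    also have "real \<dots> \<le> (B + \<epsilon>') * length \<rho>" by (rule \<rho>)
    also have "\<dots> \<le> (B + \<epsilon>') * N"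
      using N(1) \<open>B > 0\<close> \<epsilon> by (intro mult_left_mono) auto
    finally show ?thesis .
  qed
  have high: "real (hamming (prefix_of X N) (take N \<rho>')) \<le> (B + \<epsilon>) * N"
    if N: "n \<le> N" "N \<le> n + j * L" for N
  proof -
    have "hamming (prefix_of X n) \<kappa> \<le> length \<rho>"
    proof -
      have "prefix_of X n = prefix_of X (length \<rho>) @ drop (length \<rho>) (prefix_of X n)"
        using n\<rho> by (simp add: prefix_of_split[of "length \<rho>" n])
      then have "hamming (prefix_of X n) \<kappa> = hamming (prefix_of X (length \<rho>)) \<rho>"
        unfolding \<kappa>_def by (metis hamming_append hamming_refl length_prefix_of add_0_right)
      then show ?thesis using hamming_le_length[of "prefix_of X (length \<rho>)" \<rho>] by simp
    qed
    moreover have "take (N - n) v = map X [n..<N]"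
      using N by (simp add: v_def take_map)
    then have "hamming (prefix_of X N) (take N \<rho>') =
        hamming (prefix_of X n) \<kappa> + hamming (take (N - n) v) (take (N - n) \<tau>)"
      using N by (simp add: \<rho>'_def len\<kappa> prefix_of_split[OF N(1)] hamming_append)
    moreover have "real (hamming (take (N - n) v) (take (N - n) \<tau>)) \<le> c * (real N - n) + L"
      using P(4)[of "N - n"] N by (simp add: of_nat_diff)
    \<comment> \<open>(N - n) / N increases with N, and N \<le> n (1 + \<mu>), so it is at most
      \<mu> / (1 + \<mu>) = B / c.\<close>
    moreover have "c * (real N - n) \<le> B * N"
    proof -
      have "real N \<le> n * (1 + \<mu>)"
      proof -
        have "real N \<le> real n + real j * L" using N(2) by (metis of_nat_add of_nat_le_iff of_nat_mult)
        then show ?thesis using j(1) by (simp add: algebra_simps)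
      qed
      then have "(real N - n) * (1 + \<mu>) \<le> \<mu> * N" by (simp add: algebra_simps)
      then have "c * ((real N - n) * (1 + \<mu>)) \<le> c * (\<mu> * N)" using c by simp
      also have "\<dots> = B * N * (1 + \<mu>)" using arg_cong[OF B, of "\<lambda>x. x * N"] by (simp add: algebra_simps)
      finally have "c * (real N - n) * (1 + \<mu>) \<le> B * N * (1 + \<mu>)" by (simp only: mult.assoc)
      then show ?thesis using \<mu>(1) by simp
    qed
    moreover have "length \<rho> + L \<le> \<epsilon> * N"
    proof -
      have "real (length \<rho> + L) \<le> \<eta> * n" using big tL by simp
      also have "\<dots> \<le> \<epsilon> * N" using N \<epsilon> by (intro mult_mono) (auto simp: \<eta>_def)
      finally show ?thesis .
    qed
    ultimately show ?thesis by (simp add: algebra_simps)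
  qed
  have "prefix \<rho> \<rho>'" by (simp add: \<rho>'_def \<kappa>_def)
  moreover have "real (hamming (prefix_of X N) (take N \<rho>')) \<le> (B + \<epsilon>') * N"
    if N: "length \<rho> \<le> N" "N \<le> length \<rho>'" for N
  proof (cases "N \<le> n")
    case False
    then have "real (hamming (prefix_of X N) (take N \<rho>')) \<le> (B + \<epsilon>) * N"
      using N len by (intro high) auto
    also have "\<dots> \<le> (B + \<epsilon>') * N" using \<epsilon> by (intro mult_right_mono) auto
    finally show ?thesis .
  qed (use low N in simp)
  moreover have "real (hamming (prefix_of X (length \<rho>')) \<rho>') \<le> (B + \<epsilon>) * length \<rho>'"
    using high[of "length \<rho>'"] by (simp add: len)
  ultimately show ?thesis
    using KC n\<rho> len by (intro exI[of _ \<rho>']) auto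
qed

section \<open>The limit sequence\<close>

lemma prefix_chain_limit:
  assumes "\<And>k :: nat. prefix (f k) (f (Suc k))" "\<And>k. length (f k) < length (f (Suc k))"
  shows "\<exists>Z. \<forall>k N. N \<le> length (f k) \<longrightarrow> prefix_of Z N = take N (f k)"
proof -
  have pre: "prefix (f k) (f l)" if "k \<le> l" for k l
    using that by (induction rule: dec_induct) (auto intro: prefix_order.trans assms(1))
  have len: "k \<le> length (f k)" for k
    by (induction k) (use assms(2) le_less_trans Suc_le_eq in blast)+
  have nth: "f k ! i = f l ! i" if "i < length (f k)" "i < length (f l)" for k l i
    using pre[of k l] pre[of l k] that by (metis nle_le nth_append prefix_def)
  show ?thesis
  proof (intro exI allI impI)
    fix k N assume N: "N \<le> length (f k)"
    \<comment> \<open>Bit i is read from \<open>f (Suc i)\<close>, whose length exceeds i.\<close>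
    show "prefix_of (\<lambda>i. f (Suc i) ! i) N = take N (f k)"
    proof (rule nth_equalityI)
      fix i assume "i < length (prefix_of (\<lambda>i. f (Suc i) ! i) N)"
      then have "i < N" by simp
      then show "prefix_of (\<lambda>i. f (Suc i) ! i) N ! i = take N (f k) ! i"
        using N nth[of i "Suc i" k] len[of "Suc i"] by (simp add: prefix_of_def)
    qed (use N in simp)
  qed
qed

theorem theorem4p5:
  fixes U :: "bool list \<Rightarrow> bool list option" and X :: "nat \<Rightarrow> bool" and s t :: real
  assumes "universal_pf U"
    and "0 < s" and "s < 1"
    and "eff_dim U X = ereal s"
    and "1 - bin_entropy (1 - 2 powr (s - 1)) < t" and "t < s"
  shows "\<exists>Z. eff_dim U Z \<le> ereal t \<and>
    seq_dist X Z \<le> ereal ((1 - 2 powr (s - 1)) / (s - 1 + bin_entropy (1 - 2 powr (s - 1))) * (s - t))"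
proof -
  define c where "c = 1 - 2 powr (s - 1)"
  define B where "B = c * ((s - t) / (s - (1 - bin_entropy c)))"
  have "2 powr (s - 1) < 2 powr 0" using \<open>s < 1\<close> by (intro powr_less_mono) auto
  then have c: "0 < c" "c < 1" by (auto simp: c_def)
  \<comment> \<open>Stage k starts with tolerance 1/(k+1) and ends with 1/(k+2), which is the
    starting tolerance of the next stage.\<close>
  define Q where "Q k \<rho> \<rho>' \<longleftrightarrow> prefix \<rho> \<rho>' \<and> length \<rho> < length \<rho>' \<and>
    real (KC U \<rho>') \<le> (t + 1 / Suc (Suc k)) * length \<rho>' \<and>
    (\<forall>N. length \<rho> \<le> N \<longrightarrow> N \<le> length \<rho>' \<longrightarrow>
      real (hamming (prefix_of X N) (take N \<rho>')) \<le> (B + 1 / Suc k) * N)" for k \<rho> \<rho>'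
  define I where "I k \<rho> \<longleftrightarrow> real (hamming (prefix_of X (length \<rho>)) \<rho>) \<le> (B + 1 / Suc k) * length \<rho>" for k \<rho>
  have "\<exists>f. \<forall>k. I k (f k) \<and> Q k (f k) (f (Suc k))"
  proof (rule dependent_nat_choice)
    show "\<exists>\<rho>. I 0 \<rho>" by (rule exI[of _ "[]"]) (simp add: I_def prefix_of_def)
    show "\<exists>\<rho>'. I (Suc k) \<rho>' \<and> Q k \<rho> \<rho>'" if "I k \<rho>" for \<rho> k
    proof -
      have "1 / real (Suc (Suc k)) \<le> 1 / real (Suc k)" by (simp add: field_simps)
      from extension_step[OF assms(1,4) c assms(5)[folded c_def] assms(6) _ this,
          OF _ that[unfolded I_def B_def]]
      show ?thesis unfolding I_def Q_def B_def by fastforce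
    qed
  qed
  then obtain f where f: "\<And>k. Q k (f k) (f (Suc k))" by blast
  obtain Z where Z: "\<And>k N. N \<le> length (f k) \<Longrightarrow> prefix_of Z N = take N (f k)"
    using prefix_chain_limit[of f] f unfolding Q_def by blast
  have grow: "k \<le> length (f k)" for k
  proof (induction k)
    case (Suc k)
    then show ?case using f[of k] unfolding Q_def by linarith
  qed simp
  \<comment> \<open>For a liminf the prefixes \<open>f (Suc k)\<close>, of unbounded length, are
    enough.\<close>
  have "eff_dim U Z \<le> ereal t"
  proof (rule ccontr)
    assume "\<not> ?thesis"
    then obtain r where r: "ereal t < ereal r" "ereal r < eff_dim U Z"
      using ereal_dense2[of "ereal t" "eff_dim U Z"] by (auto simp: not_le)
    have "\<forall>\<^sub>F n in sequentially. ereal r < ereal (real (KC U (prefix_of Z n)) / real n)"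
      by (rule less_LiminfD) (use r(2) in \<open>simp add: eff_dim_def\<close>)
    then obtain M where M: "\<And>n. n \<ge> M \<Longrightarrow> r < real (KC U (prefix_of Z n)) / real n"
      by (auto simp: eventually_sequentially)
    obtain k0 where k0: "1 / real (Suc k0) < r - t"
      using r(1) reals_Archimedean[of "r - t"] by (auto simp: inverse_eq_divide)
    define k where "k = max k0 M"
    have "1 / real (Suc (Suc k)) \<le> 1 / real (Suc k0)" by (simp add: k_def frac_le)
    then have "t + 1 / real (Suc (Suc k)) < r" using k0 by linarith
    moreover have pos: "length (f (Suc k)) > 0" "length (f (Suc k)) \<ge> M"
      using grow[of "Suc k"] by (auto simp: k_def)
    moreover have "real (KC U (f (Suc k))) \<le> (t + 1 / Suc (Suc k)) * length (f (Suc k))"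
      using f[of k] unfolding Q_def by blast
    moreover have "prefix_of Z (length (f (Suc k))) = f (Suc k)" using Z[OF order_refl] by simp
    ultimately show False
      using M[OF pos(2)] by (simp add: less_divide_eq) (smt (verit) mult_right_mono of_nat_0_le_iff)
  qed
  moreover have "seq_dist X Z \<le> ereal B"
  proof (rule ereal_le_epsilon2)
    fix e :: real assume "0 < e"
    then obtain k where k: "1 / real (Suc k) < e"
      using reals_Archimedean[of e] by (auto simp: inverse_eq_divide)
    \<comment> \<open>The limsup needs every N: the intervals between consecutive lengths leave no
      gap, and from stage k on each has tolerance below e.\<close>
    have ind: "\<forall>N. length (f k) \<le> N \<longrightarrow> N \<le> length (f l) \<longrightarrow>
        real (hamming (prefix_of X N) (prefix_of Z N)) \<le> (B + e) * N" if "k < l" for l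
      using that
    proof (induction l)
      case (Suc l)
      show ?case
      proof (intro allI impI)
        fix N assume N: "length (f k) \<le> N" "N \<le> length (f (Suc l))"
        show "real (hamming (prefix_of X N) (prefix_of Z N)) \<le> (B + e) * N"
        proof (cases "length (f l) \<le> N")
          case True
          then have "real (hamming (prefix_of X N) (prefix_of Z N)) \<le> (B + 1 / Suc l) * N"
            using f[of l] N Z unfolding Q_def by simp
          also have "\<dots> \<le> (B + e) * N"
          proof (rule mult_right_mono)
            have "1 / real (Suc l) \<le> 1 / real (Suc k)" using Suc.prems by (simp add: frac_le)
            then show "B + 1 / Suc l \<le> B + e" using k by linarith
          qed simp
          finally show ?thesis .
        next
          case False
          then have "k < l" using N Suc.prems by (cases "k = l") auto
          then show ?thesis using Suc.IH N False by auto
        qed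
      qed
    qed simp
    show "seq_dist X Z \<le> ereal B + ereal e"
      unfolding seq_dist_def plus_ereal.simps
    proof (rule Limsup_bounded, rule eventually_sequentiallyI[of "Suc (length (f k))"])
      fix N assume N: "Suc (length (f k)) \<le> N"
      have "real (hamming (prefix_of X N) (prefix_of Z N)) \<le> (B + e) * N"
        using ind[of "Suc (max k N)"] N grow[of "Suc (max k N)"] by simp
      moreover have "hamming (prefix_of X N) (prefix_of Z N) = card {m. m < N \<and> X m \<noteq> Z m}"
        by (subst hamming_prefix_of)
          (auto simp: prefix_of_def intro!: arg_cong[where f = card])
      ultimately show "ereal (real (card {m. m < N \<and> X m \<noteq> Z m}) / real N) \<le> ereal (B + e)"
        using N by (simp add: divide_le_eq)
    qed
  qed
  moreover have "B = c / (s - 1 + bin_entropy c) * (s - t)"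
    by (simp add: B_def algebra_simps)
  ultimately show ?thesis unfolding c_def by auto
qed

end
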